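(* Let $K$ be a valued field whose value group $G=\langle g_0\rangle$ is cyclic. Let $E$ be a $K$-Banach space and suppose that $X:=\|E\setminus\{0\}\|$, the set of norms of nonzero vectors, is a $G$-module with convex base $B$. Then $E$ is a Norm Hilbert space if and only if $B$ is well ordered.
   Context: $K$ is a field with a non-archimedean valuation $|\cdot|:K\to G\cup\{0\}$, where the value group $G=\{|\lambda|:\lambda\in K,\lambda\ne 0\}$ is a cyclic subgroup of $(\mathbb{R}^+,\cdot)$. A $G$-module is a linearly ordered set $(X,\le)$ with no smallest element on which $G$ acts by $(g,x)\mapsto gx$ so that for all $g,g_1,g_2\in G$, $x,x_1,x_2\in X$: (i) $g_1\le g_2\Rightarrow g_1x\le g_2x$; (ii) $x_1\le x_2\Rightarrow gx_1\le gx_2$; (iii) each orbit $Gx$ is coinitial in $X$. A smallest element $0$ is adjoined to $X$, with $g0=0$ for $g\in G$ and $0x=0$. A base of $X$ is a subset $B\subseteq X$ containing exactly one element of each orbit $Gx$. A convex base is a base that is convex as a subset of the ordered set $X$. $B$ is well ordered if every nonempty subset of $B$ has a least element (for the order inherited from $X$). An $X$-norm on a $K$-vector space $E$ is a map $\|\cdot\|:E\to X\cup\{0\}$ with $\|v\|=0\iff v=0$, $\|\lambda v\|=|\lambda|\|v\|$, $\|v+w\|\le\max(\|v\|,\|w\|)$. The norm topology has as a base of neighbourhoods of $a$ the sets $\{v:\|v-a\|<s\}$, $s\in X$. $E$ is an ($X$-normed) Banach space if it is complete in this topology. A closed subspace $D$ of $E$ is orthocomplemented if there is a subspace $S$ with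 $E=D\oplus S$ and $\|d+s\|=\max(\|d\|,\|s\|)$ for all $d\in D$, $s\in S$. A Banach space $E$ is a Norm Hilbert space (NHS) if every closed subspace of $E$ is orthocomplemented. *)

theory Defs
  imports "HOL-Analysis.Abstract_Limits" "HOL-Library.Option_ord"
begin

definition valuation :: "('k::field \<Rightarrow> real) \<Rightarrow> bool" where
  "valuation v \<longleftrightarrow>
     (\<forall>a. 0 \<le> v a) \<and> (\<forall>a. v a = 0 \<longleftrightarrow> a = 0) \<and>
     (\<forall>a b. v (a * b) = v a * v b) \<and> (\<forall>a b. v (a + b) \<le> max (v a) (v b))"

definition value_group :: "('k::field \<Rightarrow> real) \<Rightarrow> real set" where
  "value_group v = {v a |a. a \<noteq> 0}"

definition cyclic_group :: "real \<Rightarrow> real set" where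
  "cyclic_group g = range (\<lambda>n::int. g powi n)"

(* The linearly ordered set is a subset X of a type of class linorder, so that it may be empty
   (which happens for the norm values of the zero space). *)
definition G_module :: "real set \<Rightarrow> 'x::linorder set \<Rightarrow> (real \<Rightarrow> 'x \<Rightarrow> 'x) \<Rightarrow> bool" where
  "G_module G X act \<longleftrightarrow>
     \<not> (\<exists>m\<in>X. \<forall>x\<in>X. m \<le> x) \<and>
     (\<forall>g\<in>G. \<forall>x\<in>X. act g x \<in> X) \<and>
     (\<forall>x\<in>X. act 1 x = x) \<and>
     (\<forall>g\<in>G. \<forall>h\<in>G. \<forall>x\<in>X. act (g * h) x = act g (act h x)) \<and>
     (\<forall>g\<in>G. \<forall>h\<in>G. \<forall>x\<in>X. g \<le> h \<longrightarrow> act g x \<le> act h x) \<and>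
     (\<forall>g\<in>G. \<forall>x\<in>X. \<forall>y\<in>X. x \<le> y \<longrightarrow> act g x \<le> act g y) \<and>
     (\<forall>x\<in>X. \<forall>y\<in>X. \<exists>g\<in>G. act g x \<le> y)"

definition orbit :: "real set \<Rightarrow> (real \<Rightarrow> 'x \<Rightarrow> 'x) \<Rightarrow> 'x \<Rightarrow> 'x set" where
  "orbit G act x = (\<lambda>g. act g x) ` G"

definition is_base :: "real set \<Rightarrow> 'x set \<Rightarrow> (real \<Rightarrow> 'x \<Rightarrow> 'x) \<Rightarrow> 'x set \<Rightarrow> bool" where
  "is_base G X act B \<longleftrightarrow> B \<subseteq> X \<and> (\<forall>x\<in>X. \<exists>!b. b \<in> B \<and> b \<in> orbit G act x)"

definition convex_base :: "real set \<Rightarrow> 'x::linorder set \<Rightarrow> (real \<Rightarrow> 'x \<Rightarrow> 'x) \<Rightarrow> 'x set \<Rightarrow> bool" where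
  "convex_base G X act B \<longleftrightarrow>
     is_base G X act B \<and> (\<forall>a\<in>B. \<forall>b\<in>B. \<forall>x\<in>X. a \<le> x \<and> x \<le> b \<longrightarrow> x \<in> B)"

definition well_ordered :: "'x::linorder set \<Rightarrow> bool" where
  "well_ordered B \<longleftrightarrow> (\<forall>S. S \<subseteq> B \<and> S \<noteq> {} \<longrightarrow> (\<exists>m\<in>S. \<forall>x\<in>S. m \<le> x))"

(* X with 0 adjoined is modelled by the option type, ordered by Option_ord: None is the
   adjoined smallest element 0. *)
definition act0 :: "(real \<Rightarrow> 'x \<Rightarrow> 'x) \<Rightarrow> real \<Rightarrow> 'x option \<Rightarrow> 'x option" where
  "act0 act r x = (if r = 0 then None else map_option (act r) x)"

definition X_norm ::
  "('k::field \<Rightarrow> real) \<Rightarrow> 'x::linorder set \<Rightarrow> (real \<Rightarrow> 'x \<Rightarrow> 'x) \<Rightarrow>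
   ('k \<Rightarrow> 'e::ab_group_add \<Rightarrow> 'e) \<Rightarrow> ('e \<Rightarrow> 'x option) \<Rightarrow> bool" where
  "X_norm v X act scale nrm \<longleftrightarrow>
     (\<forall>u. nrm u \<in> insert None (Some ` X)) \<and>
     (\<forall>u. nrm u = None \<longleftrightarrow> u = 0) \<and>
     (\<forall>c u. nrm (scale c u) = act0 act (v c) (nrm u)) \<and>
     (\<forall>u w. nrm (u + w) \<le> max (nrm u) (nrm w))"

definition norm_values :: "('e::zero \<Rightarrow> 'x option) \<Rightarrow> 'x set" where
  "norm_values nrm = {x. \<exists>u. u \<noteq> 0 \<and> nrm u = Some x}"

definition nball :: "('e::ab_group_add \<Rightarrow> 'x::linorder option) \<Rightarrow> 'e \<Rightarrow> 'x \<Rightarrow> 'e set" where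
  "nball nrm a s = {u. nrm (u - a) < Some s}"

(* The disjunct U = UNIV matters only if X is empty: then there are no balls, and the
   whole (zero) space must still be open. *)
definition norm_topology ::
  "'x::linorder set \<Rightarrow> ('e::ab_group_add \<Rightarrow> 'x option) \<Rightarrow> 'e topology" where
  "norm_topology X nrm =
     topology (\<lambda>U. U = UNIV \<or> (\<forall>a\<in>U. \<exists>s\<in>X. nball nrm a s \<subseteq> U))"

lemma nball_mono: "s \<le> t \<Longrightarrow> nball nrm a s \<subseteq> nball nrm a t"
  by (auto simp: nball_def intro: less_le_trans)

lemma openin_norm_topology:
  "openin (norm_topology X nrm) U \<longleftrightarrow> U = UNIV \<or> (\<forall>a\<in>U. \<exists>s\<in>X. nball nrm a s \<subseteq> U)"
proof -
  let ?P = "\<lambda>U. U = UNIV \<or> (\<forall>a\<in>U. \<exists>s\<in>X. nball nrm a s \<subseteq> U)"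
  have int: "?P (S \<inter> T)" if "?P S" "?P T" for S T
  proof (cases "S = UNIV \<or> T = UNIV")
    case True
    then show ?thesis using that by auto
  next
    case False
    have "\<exists>s\<in>X. nball nrm a s \<subseteq> S \<inter> T" if a: "a \<in> S \<inter> T" for a
    proof -
      obtain s t where "s \<in> X" "nball nrm a s \<subseteq> S" "t \<in> X" "nball nrm a t \<subseteq> T"
        using False \<open>?P S\<close> \<open>?P T\<close> a by blast
      moreover have "min s t \<in> X"
        using \<open>s \<in> X\<close> \<open>t \<in> X\<close> by (simp add: min_def)
      ultimately show ?thesis
        using nball_mono[of "min s t" s nrm a] nball_mono[of "min s t" t nrm a]
        by (intro bexI[of _ "min s t"]) auto
    qed
    then show ?thesis by blast
  qed
  have un: "?P (\<Union>\<K>)" if "\<forall>S\<in>\<K>. ?P S" for \<K>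
  proof (cases "UNIV \<in> \<K>")
    case True
    then show ?thesis by blast
  next
    case False
    then have "\<exists>s\<in>X. nball nrm a s \<subseteq> \<Union>\<K>" if "a \<in> \<Union>\<K>" for a
      using that \<open>\<forall>S\<in>\<K>. ?P S\<close> by (metis Sup_upper2 UnionE)
    then show ?thesis by blast
  qed
  have "istopology ?P"
    unfolding istopology_def using int un by blast
  then show ?thesis
    by (simp add: norm_topology_def topology_inverse')
qed

lemma topspace_norm_topology [simp]: "topspace (norm_topology X nrm) = UNIV"
  using openin_norm_topology[of X nrm UNIV] openin_subset by blast

(* Completeness for arbitrary Cauchy filters (equivalently, nets), not just sequences. *)
definition norm_cauchy ::
  "'x::linorder set \<Rightarrow> ('e::ab_group_add \<Rightarrow> 'x option) \<Rightarrow> 'e filter \<Rightarrow> bool" where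
  "norm_cauchy X nrm F \<longleftrightarrow>
     F \<noteq> bot \<and> (\<forall>s\<in>X. eventually (\<lambda>(u, w). nrm (u - w) < Some s) (F \<times>\<^sub>F F))"

definition norm_complete ::
  "'x::linorder set \<Rightarrow> ('e::ab_group_add \<Rightarrow> 'x option) \<Rightarrow> bool" where
  "norm_complete X nrm \<longleftrightarrow>
     (\<forall>F. norm_cauchy X nrm F \<longrightarrow> (\<exists>a. limitin (norm_topology X nrm) (\<lambda>u. u) a F))"

definition Banach_space ::
  "('k::field \<Rightarrow> real) \<Rightarrow> 'x::linorder set \<Rightarrow> (real \<Rightarrow> 'x \<Rightarrow> 'x) \<Rightarrow>
   ('k \<Rightarrow> 'e::ab_group_add \<Rightarrow> 'e) \<Rightarrow> ('e \<Rightarrow> 'x option) \<Rightarrow> bool" where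
  "Banach_space v X act scale nrm \<longleftrightarrow>
     vector_space scale \<and> X_norm v X act scale nrm \<and> norm_complete X nrm"

definition orthocomplemented ::
  "('k::field \<Rightarrow> 'e::ab_group_add \<Rightarrow> 'e) \<Rightarrow> ('e \<Rightarrow> 'x::linorder option) \<Rightarrow> 'e set \<Rightarrow> bool" where
  "orthocomplemented scale nrm D \<longleftrightarrow>
     (\<exists>S. module.subspace scale S \<and>
          D \<inter> S = {0} \<and> (\<forall>u. \<exists>d\<in>D. \<exists>s\<in>S. u = d + s) \<and>
          (\<forall>d\<in>D. \<forall>s\<in>S. nrm (d + s) = max (nrm d) (nrm s)))"

definition norm_Hilbert_space ::
  "('k::field \<Rightarrow> real) \<Rightarrow> 'x::linorder set \<Rightarrow> (real \<Rightarrow> 'x \<Rightarrow> 'x) \<Rightarrow>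
   ('k \<Rightarrow> 'e::ab_group_add \<Rightarrow> 'e) \<Rightarrow> ('e \<Rightarrow> 'x option) \<Rightarrow> bool" where
  "norm_Hilbert_space v X act scale nrm \<longleftrightarrow>
     Banach_space v X act scale nrm \<and>
     (\<forall>D. module.subspace scale D \<and> closedin (norm_topology X nrm) D
          \<longrightarrow> orthocomplemented scale nrm D)"

end

theory Submission imports Defs begin

text \<open>
  If \<open>X\<close> is empty, both sides hold trivially. Otherwise the value group is not trivial and has a
  generator \<open>g < 1\<close>. No orbit has a least element, so \<open>g\<close> moves every point of
  \<open>X\<close>; and because the base \<open>B\<close> is convex, its translate by \<open>g\<close> lies entirely below \<open>B\<close>
  (\<open>convex_base_contraction_less\<close>). Hence \<open>X\<close> is a stack of copies of \<open>B\<close> indexed by the integers,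
  \<open>\<dots> < g\<^sup>2 B < g B < B < \<dots>\<close>. Both directions rest on best approximation in closed subspaces.

  If \<open>B\<close> is well ordered, so is each final segment of the stack (\<open>well_ordered_above\<close>). The
  distances from a vector outside a closed subspace \<open>M\<close> to the elements of \<open>M\<close> are bounded below,
  so one of them is minimal (\<open>best_approximation\<close>). By Zorn's lemma take a maximal subspace \<open>S\<close>
  orthogonal to the given closed subspace \<open>D\<close>. Maximality makes \<open>S\<close> closed, completeness then makes
  \<open>D + S\<close> closed (\<open>orthogonal_sum_closed\<close>), and if \<open>D + S\<close> were not everything, the difference
  of a vector and its best approximation in \<open>D + S\<close> could be adjoined to \<open>S\<close>
  (\<open>closed_subspace_orthocomplemented\<close>).

  If \<open>B\<close> is not well ordered, some nonempty \<open>A \<subseteq> B\<close> has no least element. Choose vectors \<open>e t\<close> of norm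
  \<open>t\<close> for \<open>t \<in> A\<close>; they are orthogonal, as their norms lie in different orbits. Let \<open>D\<close> be the
  closure of the space of finite combinations of the \<open>e t\<close> with coefficient sum zero. For
  \<open>t0 \<in> A\<close>, the vectors \<open>e t0 - (e t0 - e t) = e t\<close> show that the distances from \<open>e t0\<close> to \<open>D\<close> go
  below every element of \<open>A\<close>; but a combination with coefficient sum one has a coefficient of
  value at least one, so each single distance is at least some element of \<open>A\<close>. (This passes to the
  closure because all of \<open>A\<close> lies above the element \<open>g t0\<close> of \<open>X\<close>.) No distance is
  minimal, whereas an orthogonal projection would attain the minimum
  (\<open>not_orthocomplemented_of_not_well_ordered\<close>).
\<close>

section \<open>Value group action and norm\<close>

locale X_normed_space = vector_space scale
  for scale :: "'k::field \<Rightarrow> 'e::ab_group_add \<Rightarrow> 'e" +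
  fixes v :: "'k \<Rightarrow> real" and X :: "'x::linorder set"
    and act :: "real \<Rightarrow> 'x \<Rightarrow> 'x" and nrm :: "'e \<Rightarrow> 'x option"
  assumes valuation: "valuation v"
    and G_module: "G_module (value_group v) X act"
    and X_norm: "X_norm v X act scale nrm"
    and norm_values: "X = norm_values nrm"
begin

abbreviation "G \<equiv> value_group v"
abbreviation "T \<equiv> norm_topology X nrm"

lemma v_mult: "v (a * b) = v a * v b"
  and v_eq_0_iff: "v a = 0 \<longleftrightarrow> a = 0"
  and v_ge_0: "0 \<le> v a"
  and v_add_le: "v (a + b) \<le> max (v a) (v b)"
  using valuation by (auto simp: valuation_def)

lemma v_0: "v 0 = 0"
  by (simp add: v_eq_0_iff)

lemma v_one: "v 1 = 1"
  using v_mult[of 1 1] v_eq_0_iff[of 1] by simp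

lemma v_minus_one: "v (-1) = 1"
proof -
  have "(v (-1))\<^sup>2 = 1"
    using v_mult[of "-1" "-1"] v_one by (simp add: power2_eq_square)
  then show ?thesis
    using v_ge_0[of "-1"] by (simp add: power2_eq_1_iff)
qed

lemma v_in_G: "a \<noteq> 0 \<Longrightarrow> v a \<in> G"
  by (auto simp: value_group_def)

lemma one_in_G: "1 \<in> G"
  using v_in_G[of 1] v_one by simp

lemma G_pos: "g \<in> G \<Longrightarrow> 0 < g"
  using v_ge_0 v_eq_0_iff by (fastforce simp: value_group_def less_le)

lemma G_mult: "g \<in> G \<Longrightarrow> h \<in> G \<Longrightarrow> g * h \<in> G"
  unfolding value_group_def by (auto simp: v_mult[symmetric])

lemma G_inverse: assumes "g \<in> G" shows "inverse g \<in> G"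
proof -
  obtain a where a: "a \<noteq> 0" "g = v a"
    using assms by (auto simp: value_group_def)
  have "v (inverse a) * g = 1"
    using a v_mult[of "inverse a" a] v_one by simp
  then have "inverse g = v (inverse a)"
    by (metis inverse_unique mult.commute)
  then show ?thesis
    using v_in_G[of "inverse a"] a by simp
qed

lemma act_in_X: "g \<in> G \<Longrightarrow> x \<in> X \<Longrightarrow> act g x \<in> X"
  and act_one: "x \<in> X \<Longrightarrow> act 1 x = x"
  and act_mult: "g \<in> G \<Longrightarrow> h \<in> G \<Longrightarrow> x \<in> X \<Longrightarrow> act (g * h) x = act g (act h x)"
  and act_mono_left: "g \<in> G \<Longrightarrow> h \<in> G \<Longrightarrow> x \<in> X \<Longrightarrow> g \<le> h \<Longrightarrow> act g x \<le> act h x"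
  and act_mono_right: "g \<in> G \<Longrightarrow> x \<in> X \<Longrightarrow> y \<in> X \<Longrightarrow> x \<le> y \<Longrightarrow> act g x \<le> act g y"
  and orbit_coinitial: "x \<in> X \<Longrightarrow> y \<in> X \<Longrightarrow> \<exists>g\<in>G. act g x \<le> y"
  and no_least: "m \<in> X \<Longrightarrow> \<exists>x\<in>X. x < m"
  using G_module by (auto simp: G_module_def not_le)

lemma act_inverse: "g \<in> G \<Longrightarrow> x \<in> X \<Longrightarrow> act (inverse g) (act g x) = x"
  using act_mult[of "inverse g" g x] G_inverse[of g] act_one G_pos[of g] by simp

lemma act_strict_mono_right:
  assumes "g \<in> G" "x \<in> X" "y \<in> X" "x < y"
  shows "act g x < act g y"
proof (rule ccontr)
  assume "\<not> act g x < act g y"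
  then have "act (inverse g) (act g y) \<le> act (inverse g) (act g x)"
    using assms act_mono_right[of "inverse g" "act g y" "act g x"]
    by (simp add: not_less G_inverse act_in_X)
  then show False
    using assms by (simp add: act_inverse)
qed

lemma nrm_eq_None_iff: "nrm u = None \<longleftrightarrow> u = 0"
  and nrm_scale: "nrm (scale c u) = act0 act (v c) (nrm u)"
  and nrm_add_le: "nrm (u + w) \<le> max (nrm u) (nrm w)"
  using X_norm by (auto simp: X_norm_def)

lemma nrm_0: "nrm 0 = None"
  by (simp add: nrm_eq_None_iff)

lemma nrm_nonzeroE:
  assumes "u \<noteq> 0" obtains x where "x \<in> X" "nrm u = Some x"
  using X_norm assms by (auto simp: X_norm_def)

lemma in_X_nrmE:
  assumes "x \<in> X" obtains u where "u \<noteq> 0" "nrm u = Some x"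
  using assms norm_values by (auto simp: norm_values_def)

lemma nrm_minus: "nrm (- u) = nrm u"
proof (cases "u = 0")
  case False
  then obtain x where "x \<in> X" "nrm u = Some x"
    by (rule nrm_nonzeroE)
  then show ?thesis
    using nrm_scale[of "-1" u] by (simp add: scale_minus_left v_minus_one act0_def act_one)
qed simp

lemma nrm_diff_le: "nrm (u - w) \<le> max (nrm u) (nrm w)"
  using nrm_add_le[of u "- w"] by (simp add: nrm_minus)

lemma nrm_diff_commute: "nrm (u - w) = nrm (w - u)"
  using nrm_minus[of "u - w"] by simp

lemma nrm_add_less: "nrm u < r \<Longrightarrow> nrm w < r \<Longrightarrow> nrm (u + w) < r"
  using nrm_add_le[of u w] by (meson le_less_trans max_less_iff_conj)

lemma nrm_diff_less: "nrm u < r \<Longrightarrow> nrm w < r \<Longrightarrow> nrm (u - w) < r"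
  using nrm_add_less[of u r "- w"] by (simp add: nrm_minus)

text \<open>The isosceles triangle principle.\<close>

lemma nrm_add_eq_right:
  assumes "nrm u < nrm w" shows "nrm (u + w) = nrm w"
proof (rule antisym)
  show "nrm (u + w) \<le> nrm w"
    using nrm_add_le[of u w] assms by (simp add: max_absorb2 less_imp_le)
  show "nrm w \<le> nrm (u + w)"
    using nrm_diff_le[of "u + w" u] assms by (auto simp: le_max_iff_disj)
qed

lemma nrm_add_eq_max:
  assumes "nrm u \<noteq> nrm w" shows "nrm (u + w) = max (nrm u) (nrm w)"
proof (cases "nrm u < nrm w")
  case True
  then show ?thesis
    by (simp add: nrm_add_eq_right max_absorb2 less_imp_le)
next
  case False
  then have "nrm w < nrm u"
    using assms by simp
  then show ?thesis
    using nrm_add_eq_right[of w u] by (simp add: max_absorb1 less_imp_le add.commute)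
qed

lemma nrm_scale_mono:
  assumes "nrm u \<le> nrm w" shows "nrm (scale c u) \<le> nrm (scale c w)"
proof (cases "c = 0 \<or> u = 0")
  case False
  then have "w \<noteq> 0"
    using assms nrm_nonzeroE[of u] by (metis less_eq_option_Some_None nrm_0)
  then obtain x y where "x \<in> X" "nrm u = Some x" "y \<in> X" "nrm w = Some y"
    using False nrm_nonzeroE by metis
  then show ?thesis
    using False assms act_mono_right[of "v c" x y] v_in_G[of c] by (simp add: nrm_scale act0_def)
qed (auto simp: nrm_0)

lemma nrm_scale_strict_mono:
  assumes "nrm u < nrm w" "c \<noteq> 0" shows "nrm (scale c u) < nrm (scale c w)"
  using nrm_scale_mono[of "scale c w" "scale c u" "inverse c"] assms by (auto simp: not_le[symmetric])

lemma nrm_le_scale: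
  assumes "1 \<le> v c" shows "nrm u \<le> nrm (scale c u)"
proof (cases "u = 0")
  case False
  then obtain x where x: "x \<in> X" "nrm u = Some x"
    by (rule nrm_nonzeroE)
  have "c \<noteq> 0"
    using assms v_0 by auto
  then have "act 1 x \<le> act (v c) x"
    using assms x by (intro act_mono_left one_in_G v_in_G) auto
  then show ?thesis
    using x \<open>c \<noteq> 0\<close> by (simp add: nrm_scale act0_def v_eq_0_iff act_one)
qed simp

section \<open>Closure of subspaces\<close>

lemma openin_nball: "openin T (nball nrm a s)" if "s \<in> X"
  unfolding openin_norm_topology
proof (intro disjI2 ballI bexI[OF _ that])
  fix b assume "b \<in> nball nrm a s"
  then show "nball nrm b s \<subseteq> nball nrm a s"
    using nrm_add_less[of _ "Some s" "b - a"] by (fastforce simp: nball_def)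
qed

text \<open>Without the hypothesis the equivalence fails when \<open>X\<close> is empty: there are then no balls, and the
  right-hand side holds for every vector.\<close>

lemma in_closure_iff:
  assumes "M \<noteq> {}"
  shows "u \<in> T closure_of M \<longleftrightarrow> (\<forall>s\<in>X. \<exists>m\<in>M. nrm (m - u) < Some s)"
proof
  assume u: "u \<in> T closure_of M"
  show "\<forall>s\<in>X. \<exists>m\<in>M. nrm (m - u) < Some s"
  proof
    fix s assume "s \<in> X"
    moreover have "u \<in> nball nrm u s"
      by (simp add: nball_def nrm_0)
    ultimately have "\<exists>m\<in>M. m \<in> nball nrm u s"
      using u openin_nball[of s u] unfolding in_closure_of by blast
    then show "\<exists>m\<in>M. nrm (m - u) < Some s"
      by (simp add: nball_def)
  qed
next
  assume close: "\<forall>s\<in>X. \<exists>m\<in>M. nrm (m - u) < Some s"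
  show "u \<in> T closure_of M"
    unfolding in_closure_of
  proof (intro conjI allI impI)
    fix U assume "u \<in> U \<and> openin T U"
    then show "\<exists>m. m \<in> M \<and> m \<in> U"
      using close assms unfolding openin_norm_topology nball_def by blast
  qed simp
qed

lemma subspace_nonempty: "subspace M \<Longrightarrow> M \<noteq> {}"
  using subspace_0 by blast

lemma in_closed_subspaceI:
  assumes "subspace M" "closedin T M" "\<And>s. s \<in> X \<Longrightarrow> \<exists>m\<in>M. nrm (m - u) < Some s"
  shows "u \<in> M"
  using assms in_closure_iff[of M u] closure_of_closedin[of T M] subspace_nonempty by blast

lemma subspace_closure:
  assumes M: "subspace M" shows "subspace (T closure_of M)"
proof -
  note iff = in_closure_iff[OF subspace_nonempty[OF M]]
  show ?thesis
  proof (rule subspaceI)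
    show "0 \<in> T closure_of M"
      using M by (auto simp: iff nrm_0 intro!: bexI[of _ 0] subspace_0)
  next
    fix x y assume xy: "x \<in> T closure_of M" "y \<in> T closure_of M"
    show "x + y \<in> T closure_of M"
      unfolding iff
    proof
      fix s assume "s \<in> X"
      then obtain m n where "m \<in> M" "n \<in> M" "nrm (m - x) < Some s" "nrm (n - y) < Some s"
        using xy unfolding iff by blast
      then show "\<exists>m\<in>M. nrm (m - (x + y)) < Some s"
        using nrm_add_less[of "m - x" "Some s" "n - y"] M
        by (intro bexI[of _ "m + n"]) (auto simp: algebra_simps subspace_add)
    qed
  next
    fix c x assume x: "x \<in> T closure_of M"
    show "scale c x \<in> T closure_of M"
      unfolding iff
    proof
      fix s assume "s \<in> X"
      then obtain e where e: "nrm e = Some s" "e \<noteq> 0"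
        using in_X_nrmE by metis
      show "\<exists>m\<in>M. nrm (m - scale c x) < Some s"
      proof (cases "c = 0")
        case True
        then show ?thesis
          using M by (auto simp: nrm_0 intro!: bexI[of _ 0] subspace_0)
      next
        case False
        then have "scale (inverse c) e \<noteq> 0"
          using e by simp
        then obtain r where r: "r \<in> X" "nrm (scale (inverse c) e) = Some r"
          by (rule nrm_nonzeroE)
        then obtain m where m: "m \<in> M" "nrm (m - x) < Some r"
          using x unfolding iff by blast
        then have "nrm (scale c (m - x)) < nrm (scale c (scale (inverse c) e))"
          using r False by (intro nrm_scale_strict_mono) auto
        then show ?thesis
          using m M e False
          by (intro bexI[of _ "scale c m"]) (auto simp: scale_right_diff_distrib subspace_scale)
      qed
    qed
  qed
qed

section \<open>Orthogonality and best approximation\<close>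

definition orthogonal :: "'e set \<Rightarrow> 'e set \<Rightarrow> bool" where
  "orthogonal D S \<longleftrightarrow> (\<forall>d\<in>D. \<forall>s\<in>S. nrm (d + s) = max (nrm d) (nrm s))"

text \<open>Dividing by \<open>c\<close> turns the minimality of \<open>w\<close> in its coset into a lower bound for the norm of
  \<open>m + c w\<close> by the norm of its second summand; the ultrametric inequality then bounds the first one.\<close>

lemma orthogonal_line:
  assumes M: "subspace M" and w: "\<And>m. m \<in> M \<Longrightarrow> nrm w \<le> nrm (m + w)" and m: "m \<in> M"
  shows "nrm (m + scale c w) = max (nrm m) (nrm (scale c w))"
proof (cases "c = 0")
  case False
  have "nrm w \<le> nrm (scale (inverse c) m + w)"
    using M m by (intro w subspace_scale)
  then have 1: "nrm (scale c w) \<le> nrm (m + scale c w)"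
    using nrm_scale_mono[of w "scale (inverse c) m + w" c] False
    by (simp add: scale_right_distrib)
  then have "nrm m \<le> nrm (m + scale c w)"
    using nrm_diff_le[of "m + scale c w" "scale c w"] by (simp add: max_def split: if_splits)
  then show ?thesis
    using 1 nrm_add_le[of m "scale c w"] by (intro antisym) auto
qed (simp add: nrm_0)

text \<open>Only the case of equal norms is not the isosceles principle. There an element of \<open>S\<close> closer to
  \<open>s\<close> than the norm of \<open>s\<close> can replace \<open>s\<close> without changing any of the norms involved.\<close>

lemma orthogonal_closure:
  assumes S: "subspace S" and orth: "orthogonal D S"
  shows "orthogonal D (T closure_of S)"
  unfolding orthogonal_def
proof (intro ballI)
  fix d s assume d: "d \<in> D" and s: "s \<in> T closure_of S"
  note iff = in_closure_iff[OF subspace_nonempty[OF S]]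
  show "nrm (d + s) = max (nrm d) (nrm s)"
  proof (cases "nrm d = nrm s \<and> s \<noteq> 0")
    case True
    then obtain x where x: "x \<in> X" "nrm s = Some x"
      using nrm_nonzeroE by metis
    then obtain t where t: "t \<in> S" "nrm (t - s) < Some x"
      using s unfolding iff by blast
    then have "nrm t = nrm s"
      using nrm_add_eq_right[of "t - s" s] x by simp
    then have dt: "nrm (d + t) = nrm s"
      using orth d t True by (simp add: orthogonal_def)
    have "nrm ((s - t) + (d + t)) = nrm (d + t)"
      using t dt x nrm_diff_commute[of s t] by (intro nrm_add_eq_right) simp
    then show ?thesis
      using True dt by (simp add: add.commute)
  next
    case False
    then show ?thesis
      using nrm_add_eq_max[of d s] by (cases "s = 0") (auto simp: nrm_0)
  qed
qed

text \<open>A limit \<open>u\<close> of sums \<open>d + s\<close> is itself such a sum: by orthogonality the \<open>D\<close>-components of sums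
  close to \<open>u\<close> are at least as close to each other as the sums are, so they form a Cauchy filter
  base, whose limit is the \<open>D\<close>-component of \<open>u\<close>.\<close>

lemma orthogonal_sum_closed:
  assumes complete: "norm_complete X nrm"
    and D: "subspace D" "closedin T D" and S: "subspace S" "closedin T S"
    and orth: "orthogonal D S"
  shows "closedin T {d + s |d s. d \<in> D \<and> s \<in> S}"
proof -
  let ?M = "{d + s |d s. d \<in> D \<and> s \<in> S}"
  have M: "subspace ?M"
    using D S by (intro subspace_sums)
  note iff = in_closure_iff[OF subspace_nonempty[OF M]]
  have "u \<in> ?M" if u: "u \<in> T closure_of ?M" for u
  proof (cases "X = {}")
    case True
    then have "u = 0"
      using nrm_nonzeroE by blast
    then show ?thesis
      using subspace_0[OF M] by simp
  next
    case False
    \<comment> \<open>The \<open>D\<close>-components of the sums at distance less than \<open>r\<close> from \<open>u\<close>.\<close>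
    define A where "A r = {d \<in> D. \<exists>s\<in>S. nrm (d + s - u) < Some r}" for r
    define F where "F = (INF r\<in>X. principal (A r))"
    have A_mono: "A q \<subseteq> A r" if "q \<le> r" for q r
      using that by (force simp: A_def intro: less_le_trans[of _ "Some q"])
    have ev_F: "eventually P F \<longleftrightarrow> (\<exists>r\<in>X. \<forall>d\<in>A r. P d)" for P
      unfolding F_def
    proof (subst eventually_INF_base[OF False])
      fix q r assume "q \<in> X" "r \<in> X"
      then show "\<exists>x\<in>X. principal (A x) \<le> inf (principal (A q)) (principal (A r))"
        using A_mono[OF min.cobounded1, of q r] A_mono[OF min.cobounded2, of q r]
        by (intro bexI[of _ "min q r"]) (simp, simp add: min_def)
    qed (simp add: eventually_principal)
    have A_ne: "A r \<noteq> {}" if "r \<in> X" for r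
      using u that unfolding iff A_def by blast
    have A_close: "nrm (d - d') < Some r" if dd: "d \<in> A r" "d' \<in> A r" for d d' r
    proof -
      obtain s s' where s: "s \<in> S" "nrm (d + s - u) < Some r" "s' \<in> S" "nrm (d' + s' - u) < Some r"
        and d: "d \<in> D" "d' \<in> D"
        using dd unfolding A_def by blast
      have "nrm (d - d') \<le> nrm ((d - d') + (s - s'))"
        using orth d s D S by (simp add: orthogonal_def subspace_diff)
      also have "(d - d') + (s - s') = (d + s - u) - (d' + s' - u)"
        by simp
      also have "nrm \<dots> < Some r"
        by (rule nrm_diff_less[OF s(2) s(4)])
      finally show ?thesis .
    qed
    have "norm_cauchy X nrm F"
      unfolding norm_cauchy_def
    proof (intro conjI ballI)
      show "F \<noteq> bot"
        unfolding trivial_limit_def ev_F using A_ne by blast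
    next
      fix r assume "r \<in> X"
      then have "eventually (\<lambda>d. d \<in> A r) F"
        unfolding ev_F by blast
      then show "eventually (\<lambda>(d, d'). nrm (d - d') < Some r) (F \<times>\<^sub>F F)"
        unfolding eventually_prod_filter using A_close by (intro exI conjI) auto
    qed
    then obtain a where a: "limitin T (\<lambda>u. u) a F"
      using complete unfolding norm_complete_def by blast
    \<comment> \<open>A single \<open>d\<close> is close to \<open>a\<close> and also the component of a sum close to \<open>u\<close>.\<close>
    have near: "\<exists>d\<in>A r. nrm (d - a) < Some r" if r: "r \<in> X" for r
    proof -
      have "a \<in> nball nrm a r"
        by (simp add: nball_def nrm_0)
      then have "eventually (\<lambda>d. d \<in> nball nrm a r) F"
        using a openin_nball[OF r] unfolding limitin_def by blast
      then obtain q where q: "q \<in> X" "A q \<subseteq> nball nrm a r"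
        unfolding ev_F by blast
      have "min q r \<in> X"
        using q r by (simp add: min_def)
      then obtain d where "d \<in> A (min q r)"
        using A_ne by blast
      then have "d \<in> A q" "d \<in> A r"
        using A_mono[OF min.cobounded1, of q r] A_mono[OF min.cobounded2, of q r] by blast+
      then show ?thesis
        using q(2) unfolding nball_def by blast
    qed
    have "a \<in> D"
    proof (rule in_closed_subspaceI[OF D])
      show "\<exists>m\<in>D. nrm (m - a) < Some r" if "r \<in> X" for r
        using near[OF that] by (auto simp: A_def)
    qed
    moreover have "u - a \<in> S"
    proof (rule in_closed_subspaceI[OF S])
      fix r assume "r \<in> X"
      then obtain d s where d: "nrm (d - a) < Some r" "s \<in> S" "nrm (d + s - u) < Some r"
        using near[of r] unfolding A_def by blast
      have "nrm ((d + s - u) - (d - a)) < Some r"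
        by (rule nrm_diff_less[OF d(3) d(1)])
      then show "\<exists>s\<in>S. nrm (s - (u - a)) < Some r"
        using d by (intro bexI[of _ s]) (auto simp: algebra_simps)
    qed
    moreover have "u = a + (u - a)"
      by simp
    ultimately show ?thesis
      by blast
  qed
  then have "T closure_of ?M \<subseteq> ?M"
    by blast
  then show ?thesis
    by (simp add: closure_of_subset_eq[symmetric])
qed

text \<open>Closedness bounds the distances from \<open>u\<close> to the elements of \<open>M\<close> below by some \<open>s \<in> X\<close>, and above \<open>s\<close>
  there is always a least one.\<close>

lemma best_approximation:
  assumes wo: "\<forall>s\<in>X. well_ordered {x \<in> X. s \<le> x}"
    and M: "subspace M" "closedin T M" and u: "u \<notin> M"
  obtains m where "m \<in> M" "\<And>n. n \<in> M \<Longrightarrow> nrm (u - m) \<le> nrm (u - n)"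
proof -
  define N where "N = {x. \<exists>m\<in>M. nrm (u - m) = Some x}"
  have val: "\<exists>x\<in>X. nrm (u - m) = Some x" if "m \<in> M" for m
  proof -
    have "u - m \<noteq> 0"
      using that u by auto
    then show ?thesis
      using nrm_nonzeroE by metis
  qed
  obtain s where s: "s \<in> X" "\<And>m. m \<in> M \<Longrightarrow> \<not> nrm (m - u) < Some s"
    using in_closed_subspaceI[OF M, of u] u by blast
  have "N \<subseteq> X"
    using val by (force simp: N_def)
  moreover have "N \<noteq> {}"
    using val[OF subspace_0[OF M(1)]] subspace_0[OF M(1)] unfolding N_def by blast
  moreover have "\<forall>x\<in>N. s \<le> x"
    using s(2) unfolding N_def nrm_diff_commute[of _ u] by (force simp: not_less)
  ultimately have "\<exists>x\<in>N. \<forall>y\<in>N. x \<le> y"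
    using wo s(1) unfolding well_ordered_def by blast
  then obtain x where x: "x \<in> N" "\<And>y. y \<in> N \<Longrightarrow> x \<le> y"
    by blast
  then obtain m where m: "m \<in> M" "nrm (u - m) = Some x"
    by (auto simp: N_def)
  have "nrm (u - m) \<le> nrm (u - n)" if n: "n \<in> M" for n
  proof -
    obtain y where y: "nrm (u - n) = Some y"
      using val[OF n] by blast
    then have "y \<in> N"
      using n by (auto simp: N_def)
    then show ?thesis
      using x(2) y m by simp
  qed
  with m that show thesis
    by blast
qed

text \<open>A maximal subspace orthogonal to \<open>D\<close> is a complement: orthogonality to \<open>D\<close> is preserved by unions
  of chains, by closure, and by adjoining a vector that is orthogonal to \<open>D + S\<close>. Closure is
  needed only to make best approximation available in \<open>D + S\<close>.\<close>

lemma closed_subspace_orthocomplemented: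
  assumes wo: "\<forall>s\<in>X. well_ordered {x \<in> X. s \<le> x}"
    and complete: "norm_complete X nrm"
    and D: "subspace D" "closedin T D"
  shows "orthocomplemented scale nrm D"
proof -
  let ?\<A> = "{S. subspace S \<and> orthogonal D S}"
  have "\<exists>S\<in>?\<A>. \<forall>S'\<in>?\<A>. S \<subseteq> S' \<longrightarrow> S' = S"
  proof (rule subset_Zorn_nonempty)
    have "{0} \<in> ?\<A>"
      by (auto simp: orthogonal_def nrm_0 subspace_single_0)
    then show "?\<A> \<noteq> {}"
      by blast
  next
    fix \<C> assume ne: "\<C> \<noteq> {}" and chain: "subset.chain ?\<A> \<C>"
    then have sub: "\<And>S. S \<in> \<C> \<Longrightarrow> subspace S" and orth: "\<And>S. S \<in> \<C> \<Longrightarrow> orthogonal D S"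
      by (auto simp: subset.chain_def)
    have "subspace (\<Union>\<C>)"
    proof (rule subspaceI)
      show "0 \<in> \<Union>\<C>"
        using ne sub subspace_0 by blast
    next
      fix x y assume "x \<in> \<Union>\<C>" "y \<in> \<Union>\<C>"
      then obtain P Q where PQ: "P \<in> \<C>" "Q \<in> \<C>" "x \<in> P" "y \<in> Q"
        by blast
      then have "P \<subseteq> Q \<or> Q \<subseteq> P"
        using chain unfolding subset_chain_def by blast
      then show "x + y \<in> \<Union>\<C>"
        using PQ sub subspace_add by blast
    next
      fix c x assume "x \<in> \<Union>\<C>"
      then show "scale c x \<in> \<Union>\<C>"
        using sub subspace_scale by blast
    qed
    then show "\<Union>\<C> \<in> ?\<A>"
      using orth by (auto simp: orthogonal_def)
  qed
  then obtain S where S: "subspace S" and orth: "orthogonal D S"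
    and maximal: "\<And>S'. subspace S' \<Longrightarrow> orthogonal D S' \<Longrightarrow> S \<subseteq> S' \<Longrightarrow> S' = S"
    by blast
  have "T closure_of S = S"
    using S orth by (intro maximal subspace_closure orthogonal_closure closure_of_subset) auto
  then have closed_S: "closedin T S"
    by (metis closedin_closure_of)
  define M where "M = {d + s |d s. d \<in> D \<and> s \<in> S}"
  have M: "subspace M"
    unfolding M_def using D S by (intro subspace_sums)
  have closed_M: "closedin T M"
    unfolding M_def by (rule orthogonal_sum_closed[OF complete D S closed_S orth])
  have sum_M: "d + s \<in> M" if "d \<in> D" "s \<in> S" for d s
    using that unfolding M_def by blast
  have S_M: "s \<in> M" if "s \<in> S" for s
    using sum_M[OF subspace_0[OF D(1)] that] by simp
  have "u \<in> M" for u
  proof (rule ccontr)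
    assume u: "u \<notin> M"
    obtain m where m: "m \<in> M" "\<And>n. n \<in> M \<Longrightarrow> nrm (u - m) \<le> nrm (u - n)"
      by (rule best_approximation[OF wo M closed_M u]) (rule that)
    \<comment> \<open>The error of the best approximation is orthogonal to \<open>M\<close>, so that \<open>S\<close> can be enlarged by it.\<close>
    define w where "w = u - m"
    have w: "nrm w \<le> nrm (n + w)" if "n \<in> M" for n
    proof -
      have "nrm (u - m) \<le> nrm (u - (m - n))"
        by (rule m(2)[OF subspace_diff[OF M m(1) that]])
      then show ?thesis
        by (simp add: w_def algebra_simps)
    qed
    have line: "nrm (n + scale c w) = max (nrm n) (nrm (scale c w))" if "n \<in> M" for n c
      by (intro orthogonal_line[OF M] w that)
    define S' where "S' = {s + t |s t. s \<in> S \<and> t \<in> span {w}}"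
    have S': "s + t \<in> S'" if "s \<in> S" "t \<in> span {w}" for s t
      unfolding S'_def using that by blast
    have "orthogonal D S'"
      unfolding orthogonal_def
    proof (intro ballI)
      fix d t assume d: "d \<in> D" and "t \<in> S'"
      then obtain s c where t: "s \<in> S" "t = s + scale c w"
        unfolding S'_def span_singleton by blast
      have "nrm (d + t) = nrm ((d + s) + scale c w)"
        using t by (simp add: add.assoc)
      also have "\<dots> = max (nrm (d + s)) (nrm (scale c w))"
        by (rule line[OF sum_M[OF d t(1)]])
      also have "\<dots> = max (nrm d) (max (nrm s) (nrm (scale c w)))"
        using orth d t by (simp add: orthogonal_def max.assoc)
      also have "max (nrm s) (nrm (scale c w)) = nrm (s + scale c w)"
        by (rule line[OF S_M[OF t(1)], symmetric])
      finally show "nrm (d + t) = max (nrm d) (nrm t)"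
        using t by simp
    qed
    moreover have "subspace S'"
      unfolding S'_def using S by (intro subspace_sums) auto
    moreover have "S \<subseteq> S'"
      using S'[OF _ span_zero] by auto
    ultimately have "S' = S"
      by (intro maximal)
    then have "w \<in> S"
      using S'[OF subspace_0[OF S] span_base[of w "{w}"]] by simp
    then have "m + w \<in> M"
      by (intro subspace_add[OF M m(1)] S_M)
    then show False
      using u by (simp add: w_def)
  qed
  then have "\<forall>u. \<exists>d\<in>D. \<exists>s\<in>S. u = d + s"
    unfolding M_def by blast
  moreover have "D \<inter> S = {0}"
  proof -
    have "u = 0" if "u \<in> D" "u \<in> S" for u
    proof -
      have "nrm (u + - u) = max (nrm u) (nrm (- u))"
        using orth that subspace_neg[OF S] unfolding orthogonal_def by blast
      then have "nrm u = None"
        by (simp add: nrm_0 nrm_minus)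
      then show ?thesis
        by (simp add: nrm_eq_None_iff)
    qed
    then show ?thesis
      using D S subspace_0 by blast
  qed
  ultimately show ?thesis
    unfolding orthocomplemented_def using S orth unfolding orthogonal_def by blast
qed

section \<open>Convex bases\<close>

text \<open>If \<open>g\<close> fixed \<open>x\<close>, so would its powers. They become smaller than any given element of \<open>G\<close>, so
  \<open>x\<close> would be the least element of its orbit, which is coinitial in a set without least element.\<close>

lemma contraction_moves:
  assumes g: "g \<in> G" "g < 1" and x: "x \<in> X" shows "act g x \<noteq> x"
proof
  assume fix_g: "act g x = x"
  have pow: "g ^ n \<in> G \<and> act (g ^ n) x = x" for n
  proof (induction n)
    case (Suc n)
    then show ?case
      using g x act_mult[of g "g ^ n" x] fix_g by (simp add: G_mult)
  qed (use x in \<open>simp add: one_in_G act_one\<close>)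
  obtain y where y: "y \<in> X" "y < x"
    using no_least x by blast
  then obtain h where h: "h \<in> G" "act h x \<le> y"
    using orbit_coinitial x by blast
  obtain n where "g ^ n < h"
    using real_arch_pow_inv[of h g] G_pos h g by blast
  then have "act (g ^ n) x \<le> act h x"
    using pow h x by (intro act_mono_left) auto
  then show False
    using pow[of n] h y by simp
qed

lemma self_in_orbit: "x \<in> X \<Longrightarrow> x \<in> orbit G act x"
  unfolding orbit_def by (rule image_eqI[of _ _ 1]) (simp_all add: act_one one_in_G)

lemma base_subset: "is_base G X act B \<Longrightarrow> B \<subseteq> X"
  by (simp add: is_base_def)

lemma base_unique:
  assumes "is_base G X act B" "x \<in> X" "a \<in> B" "b \<in> B" "a \<in> orbit G act x" "b \<in> orbit G act x"
  shows "a = b"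
proof -
  have "\<exists>!b. b \<in> B \<and> b \<in> orbit G act x"
    using assms(1,2) by (simp add: is_base_def)
  then show ?thesis
    using assms(3-6) by blast
qed

lemma convex_base_is_base: "convex_base G X act B \<Longrightarrow> is_base G X act B"
  by (simp add: convex_base_def)

lemma convex_baseD:
  "convex_base G X act B \<Longrightarrow> a \<in> B \<Longrightarrow> b \<in> B \<Longrightarrow> x \<in> X \<Longrightarrow> a \<le> x \<Longrightarrow> x \<le> b \<Longrightarrow> x \<in> B"
  unfolding convex_base_def by blast

text \<open>If \<open>b \<le> g a\<close>, then convexity puts \<open>g a\<close> between \<open>b\<close> and \<open>a\<close> into the base, next to the
  representative \<open>a\<close> of the same orbit.\<close>

lemma convex_base_contraction_less:
  assumes B: "convex_base G X act B" and g: "g \<in> G" "g < 1" and ab: "a \<in> B" "b \<in> B"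
  shows "act g a < b"
proof (rule ccontr)
  assume "\<not> act g a < b"
  then have le: "b \<le> act g a"
    by simp
  have X: "a \<in> X"
    using ab(1) base_subset[OF convex_base_is_base[OF B]] by blast
  have "act g a \<le> act 1 a"
    using g X by (intro act_mono_left one_in_G) auto
  then have "act g a \<le> a"
    using X by (simp add: act_one)
  then have in_B: "act g a \<in> B"
    using convex_baseD[OF B ab(2,1) act_in_X[OF g(1) X] le] by blast
  have "act g a \<in> orbit G act a"
    unfolding orbit_def using g by blast
  then have "act g a = a"
    using base_unique[OF convex_base_is_base[OF B] X in_B ab(1) _ self_in_orbit[OF X]] by blast
  then show False
    using contraction_moves g X by blast
qed

text \<open>The given generator may be larger than one; then its inverse serves. It cannot be one, because
  a trivial group has no coinitial orbits in a nonempty set without least element.\<close>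

lemma cyclic_contraction:
  assumes G: "G = cyclic_group g0" and "X \<noteq> {}"
  obtains g where "g < 1" "G = cyclic_group g"
proof -
  have "g0 \<in> G"
    unfolding G cyclic_group_def by (rule range_eqI[of _ _ 1]) simp
  then have pos: "0 < g0"
    by (rule G_pos)
  have "g0 \<noteq> 1"
  proof
    assume "g0 = 1"
    then have trivial: "G = {1}"
      by (auto simp: G cyclic_group_def)
    obtain x where x: "x \<in> X"
      using \<open>X \<noteq> {}\<close> by blast
    obtain y where y: "y \<in> X" "y < x"
      using no_least[OF x] by blast
    obtain h where "h \<in> G" "act h x \<le> y"
      using orbit_coinitial[OF x y(1)] by blast
    then show False
      using trivial y act_one[OF x] by simp
  qed
  show thesis
  proof (cases "g0 < 1")
    case True
    then show ?thesis
      using G by (rule that)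
  next
    case False
    have "G = cyclic_group (inverse g0)"
      unfolding G cyclic_group_def
    proof (intro equalityI image_subsetI)
      fix n :: int
      show "g0 powi n \<in> range (\<lambda>n. inverse g0 powi n)"
        by (rule range_eqI[of _ _ "- n"]) (simp add: power_int_minus power_int_inverse)
      show "inverse g0 powi n \<in> range (\<lambda>n. g0 powi n)"
        by (rule range_eqI[of _ _ "- n"]) (simp add: power_int_minus power_int_inverse)
    qed
    moreover have "inverse g0 < 1"
      using False \<open>g0 \<noteq> 1\<close> pos by (simp add: field_simps)
    ultimately show ?thesis
      by (rule that[rotated])
  qed
qed

lemma base_representative:
  assumes B: "is_base G X act B" and x: "x \<in> X"
  obtains g b where "g \<in> G" "b \<in> B" "x = act g b"
proof -
  obtain b g where b: "b \<in> B" "g \<in> G" "b = act g x"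
    using B x unfolding is_base_def orbit_def by blast
  then have "x = act (inverse g) b"
    using x by (simp add: act_inverse)
  then show thesis
    using b that G_inverse by blast
qed

text \<open>A nonempty set above \<open>s\<close> meets only translates \<open>g\<^sup>n B\<close>
  with \<open>n\<close> bounded above. The translate with the largest such \<open>n\<close> is the lowest one, and the least
  element of the set there is least altogether.\<close>

lemma well_ordered_above:
  assumes G: "G = cyclic_group g0" and B: "convex_base G X act B" and wo: "well_ordered B"
    and s: "s \<in> X"
  shows "well_ordered {x \<in> X. s \<le> x}"
  unfolding well_ordered_def
proof (intro allI impI)
  fix N assume "N \<subseteq> {x \<in> X. s \<le> x} \<and> N \<noteq> {}"
  then have N: "N \<subseteq> X" "N \<noteq> {}" "\<And>x. x \<in> N \<Longrightarrow> s \<le> x"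
    by auto
  have "X \<noteq> {}"
    using s by blast
  with G obtain g where g: "g < 1" and G: "G = cyclic_group g"
    by (rule cyclic_contraction)
  have pow: "g powi n \<in> G" for n :: int
    by (auto simp: G cyclic_group_def)
  have gG: "g \<in> G"
    using pow[of 1] by simp
  have g0: "0 < g"
    by (rule G_pos[OF gG])
  have base: "is_base G X act B"
    by (rule convex_base_is_base[OF B])
  then have BX: "B \<subseteq> X"
    by (rule base_subset)
  have repr: "\<exists>n. \<exists>b\<in>B. x = act (g powi n) b" if x: "x \<in> X" for x
  proof -
    obtain h b where "h \<in> G" "b \<in> B" "x = act h b"
      using base_representative[OF base x] by blast
    then show ?thesis
      unfolding G cyclic_group_def by blast
  qed
  have less: "act (g powi n) a < act (g powi k) b" if "k < n" "a \<in> B" "b \<in> B" for k n :: int and a b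
  proof -
    have a: "a \<in> X" and b: "b \<in> X"
      using that BX by auto
    have "g powi n \<le> g powi (k + 1)"
      using that g g0 by (intro power_int_decreasing) auto
    then have "act (g powi n) a \<le> act (g powi (k + 1)) a"
      using a pow by (intro act_mono_left)
    also have "\<dots> = act (g powi k) (act g a)"
      using act_mult[OF pow gG a] g0 by (simp add: power_int_add_1)
    also have "\<dots> < act (g powi k) b"
      using that a b gG g pow B
      by (intro act_strict_mono_right act_in_X convex_base_contraction_less) auto
    finally show ?thesis .
  qed
  define I where "I = {n. \<exists>b\<in>B. act (g powi n) b \<in> N}"
  obtain k c where k: "c \<in> B" "s = act (g powi k) c"
    using repr s by blast
  have I_le: "n \<le> k" if n: "n \<in> I" for n
  proof (rule ccontr)
    assume "\<not> n \<le> k"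
    obtain b where b: "b \<in> B" "act (g powi n) b \<in> N"
      using n unfolding I_def by blast
    then have "act (g powi n) b < s"
      unfolding k(2) using \<open>\<not> n \<le> k\<close> k(1) by (intro less) auto
    then show False
      using N(3)[OF b(2)] by simp
  qed
  have "I \<noteq> {}"
    using N repr unfolding I_def by blast
  then obtain i where i: "i \<in> I"
    by blast
  \<comment> \<open>\<open>n\<close> is the maximum of \<open>I\<close>, found in the finite part \<open>J\<close> of \<open>I\<close> above some member \<open>i\<close>.\<close>
  define J where "J = I \<inter> {i..k}"
  define n where "n = Max J"
  have fin: "finite J" and "i \<in> J"
    using i I_le[OF i] by (auto simp: J_def)
  then have "n \<in> J"
    unfolding n_def by (intro Max_in) auto
  then have n_I: "n \<in> I" and "i \<le> n"
    by (auto simp: J_def)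
  have n_max: "j \<le> n" if "j \<in> I" for j
  proof (cases "i \<le> j")
    case True
    then have "j \<in> J"
      using that I_le[OF that] by (simp add: J_def)
    then show ?thesis
      unfolding n_def by (rule Max_ge[OF fin])
  next
    case False
    then show ?thesis
      using \<open>i \<le> n\<close> by simp
  qed
  define C where "C = {b\<in>B. act (g powi n) b \<in> N}"
  have "C \<subseteq> B" "C \<noteq> {}"
    using n_I by (auto simp: C_def I_def)
  then have "\<exists>b\<in>C. \<forall>a\<in>C. b \<le> a"
    using wo unfolding well_ordered_def by simp
  then obtain b where b: "b \<in> C" "\<forall>a\<in>C. b \<le> a"
    by blast
  have "act (g powi n) b \<le> y" if y: "y \<in> N" for y
  proof -
    obtain j a where a: "a \<in> B" "y = act (g powi j) a"
      using repr[of y] y N(1) by blast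
    then have "j \<in> I"
      using y by (auto simp: I_def)
    then consider "j = n" | "j < n"
      using n_max[of j] by linarith
    then show ?thesis
    proof cases
      case 1
      then have "a \<in> C"
        using a y by (simp add: C_def)
      then show ?thesis
        using a(2) b 1 act_mono_right[OF pow, of b a n] a(1) BX \<open>C \<subseteq> B\<close> by blast
    next
      case 2
      then show ?thesis
        using less[of j n b a] a b by (simp add: C_def)
    qed
  qed
  then show "\<exists>m\<in>N. \<forall>x\<in>N. m \<le> x"
    using b by (auto simp: C_def)
qed

section \<open>A subspace without orthocomplement\<close>

text \<open>The second conjunct carries the induction: the norm of a nonzero partial sum is one of the norms
  already met, hence different from that of the next nonzero summand.\<close>

lemma nrm_sum_distinct:
  assumes "finite F"
    and "\<And>i j. i \<in> F \<Longrightarrow> j \<in> F \<Longrightarrow> f i \<noteq> 0 \<Longrightarrow> nrm (f i) = nrm (f j) \<Longrightarrow> i = j"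
  shows "(\<forall>i\<in>F. nrm (f i) \<le> nrm (sum f F)) \<and> (sum f F = 0 \<or> (\<exists>i\<in>F. nrm (sum f F) = nrm (f i)))"
  using assms
proof (induction F)
  case (insert x F)
  then have IH: "\<forall>i\<in>F. nrm (f i) \<le> nrm (sum f F)"
      "sum f F = 0 \<or> (\<exists>i\<in>F. nrm (sum f F) = nrm (f i))"
    by auto
  have sum: "sum f (insert x F) = f x + sum f F"
    using insert by simp
  show ?case
  proof (cases "sum f F = 0")
    case True
    have "nrm (f i) \<le> nrm (f x)" if "i \<in> F" for i
      using IH(1) True that by (auto simp: nrm_0 intro: order_trans)
    then show ?thesis
      using True by (simp add: sum)
  next
    case False
    then obtain i where i: "i \<in> F" "nrm (sum f F) = nrm (f i)"
      using IH by blast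
    have "f i \<noteq> 0"
      using False i by (metis nrm_eq_None_iff)
    then have "nrm (f x) \<noteq> nrm (sum f F)"
      using i insert.hyps insert.prems[of i x] by auto
    then have "nrm (sum f (insert x F)) = max (nrm (f x)) (nrm (sum f F))"
      by (simp add: sum nrm_add_eq_max)
    then show ?thesis
      using IH(1) i by (auto simp: max_def)
  qed
qed simp

lemma v_sum_less_1:
  assumes "finite F" "\<And>i. i \<in> F \<Longrightarrow> v (f i) < 1" shows "v (sum f F) < 1"
  using assms
proof (induction F)
  case (insert x F)
  then show ?case
    using le_less_trans[OF v_add_le[of "f x" "sum f F"], of 1] by simp
qed (simp add: v_0)

text \<open>Some coefficient has value at least one, and the norm of the sum is at least that of the
  corresponding summand, because summands over different base elements have norms in different
  orbits.\<close>

lemma nrm_combination_ge: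
  assumes B: "is_base G X act B" and F: "finite F" "F \<subseteq> B"
    and e: "\<And>t. t \<in> F \<Longrightarrow> nrm (e t) = Some t" and "sum c F = 1"
  shows "\<exists>t\<in>F. Some t \<le> nrm (\<Sum>t\<in>F. scale (c t) (e t))"
proof -
  obtain t where t: "t \<in> F" "1 \<le> v (c t)"
    using v_sum_less_1[OF F(1), of c] assms(5) v_one by force
  have BX: "B \<subseteq> X"
    by (rule base_subset[OF B])
  have "i = j" if ij: "i \<in> F" "j \<in> F" and nz: "scale (c i) (e i) \<noteq> 0"
    and eq: "nrm (scale (c i) (e i)) = nrm (scale (c j) (e j))" for i j
  proof -
    have "c i \<noteq> 0"
      using nz by auto
    moreover have "c j \<noteq> 0"
      using nz eq nrm_0 nrm_eq_None_iff by (metis scale_zero_left)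
    ultimately have act: "act (v (c i)) i = act (v (c j)) j" and G: "v (c i) \<in> G" "v (c j) \<in> G"
      using eq e ij by (simp_all add: nrm_scale act0_def v_eq_0_iff v_in_G)
    have X: "i \<in> X" "j \<in> X" and ijB: "i \<in> B" "j \<in> B"
      using ij F BX by auto
    have "i = act (inverse (v (c i)) * v (c j)) j"
      using act act_inverse[OF G(1) X(1)] act_mult[OF G_inverse[OF G(1)] G(2) X(2)] by simp
    then have "i \<in> orbit G act j"
      unfolding orbit_def using G_mult[OF G_inverse[OF G(1)] G(2)] by blast
    then show "i = j"
      by (rule base_unique[OF B X(2) ijB _ self_in_orbit[OF X(2)]])
  qed
  then have "nrm (scale (c t) (e t)) \<le> nrm (\<Sum>t\<in>F. scale (c t) (e t))"
    using nrm_sum_distinct[OF F(1), of "\<lambda>t. scale (c t) (e t)"] t(1) by blast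
  moreover have "Some t \<le> nrm (scale (c t) (e t))"
    using nrm_le_scale[OF t(2), of "e t"] e t(1) by simp
  ultimately show ?thesis
    using t(1) order_trans by blast
qed

text \<open>Allows combinations with different index sets to be added over a common one.\<close>

lemma zero_extension:
  assumes "finite H" "F \<subseteq> H"
  shows "(\<Sum>t\<in>H. if t \<in> F then c t else 0) = sum c F"
    and "(\<Sum>t\<in>H. scale (if t \<in> F then c t else 0) (e t)) = (\<Sum>t\<in>F. scale (c t) (e t))"
  using assms by (auto intro!: sum.mono_neutral_cong_right)

lemma subspace_zero_sum_combinations:
  "subspace {\<Sum>t\<in>F. scale (c t) (e t) |F c. finite F \<and> F \<subseteq> A \<and> sum c F = 0}"
    (is "subspace ?D")
proof (rule subspaceI)
  show "0 \<in> ?D"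
    by (auto intro!: exI[of _ "{}"])
next
  fix x y assume "x \<in> ?D" "y \<in> ?D"
  then obtain F c H d where F: "finite F" "F \<subseteq> A" "sum c F = 0" "x = (\<Sum>t\<in>F. scale (c t) (e t))"
    and H: "finite H" "H \<subseteq> A" "sum d H = 0" "y = (\<Sum>t\<in>H. scale (d t) (e t))"
    by blast
  define c' where "c' = (\<lambda>t. if t \<in> F then c t else 0)"
  define d' where "d' = (\<lambda>t. if t \<in> H then d t else 0)"
  have c': "sum c' (F \<union> H) = 0" "x = (\<Sum>t\<in>F \<union> H. scale (c' t) (e t))"
    unfolding c'_def using F H(1) by (simp_all add: zero_extension)
  have d': "sum d' (F \<union> H) = 0" "y = (\<Sum>t\<in>F \<union> H. scale (d' t) (e t))"
    unfolding d'_def using F(1) H by (simp_all add: zero_extension)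
  have "x + y = (\<Sum>t\<in>F \<union> H. scale (c' t + d' t) (e t))"
    by (simp add: c'(2) d'(2) sum.distrib scale_left_distrib)
  moreover have "(\<Sum>t\<in>F \<union> H. c' t + d' t) = 0"
    by (simp add: sum.distrib c'(1) d'(1))
  ultimately show "x + y \<in> ?D"
    using F(1,2) H(1,2) by (auto intro!: exI[of _ "F \<union> H"] exI[of _ "\<lambda>t. c' t + d' t"])
next
  fix a x assume "x \<in> ?D"
  then obtain F c where F: "finite F" "F \<subseteq> A" "sum c F = 0" "x = (\<Sum>t\<in>F. scale (c t) (e t))"
    by blast
  have "scale a x = (\<Sum>t\<in>F. scale (a * c t) (e t))"
    by (simp add: F(4) scale_sum_right)
  moreover have "(\<Sum>t\<in>F. a * c t) = 0"
    using F(3) by (simp add: sum_distrib_left[symmetric])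
  ultimately show "scale a x \<in> ?D"
    using F(1,2) by (auto intro!: exI[of _ F] exI[of _ "\<lambda>t. a * c t"])
qed

text \<open>The best approximation is the orthogonal projection.\<close>

lemma orthocomplemented_imp_best_approximation:
  assumes "orthocomplemented scale nrm D" "subspace D"
  obtains d where "d \<in> D" "\<And>d'. d' \<in> D \<Longrightarrow> nrm (u - d) \<le> nrm (u - d')"
proof -
  obtain S d s where S: "\<forall>d\<in>D. \<forall>s\<in>S. nrm (d + s) = max (nrm d) (nrm s)"
    and ds: "d \<in> D" "s \<in> S" "u = d + s"
    using assms(1) unfolding orthocomplemented_def by metis
  have "nrm (u - d) \<le> nrm (u - d')" if "d' \<in> D" for d'
  proof -
    have "nrm ((d - d') + s) = max (nrm (d - d')) (nrm s)"
      using S ds subspace_diff[OF assms(2) ds(1) that] by blast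
    moreover have "u - d' = (d - d') + s" "u - d = s"
      using ds by auto
    ultimately show ?thesis
      by (simp only: max.cobounded2)
  qed
  with ds that show thesis
    by blast
qed

text \<open>The witness is the closure of the kernel of the coefficient sum. Writing it this way avoids
  extending the coefficient sum to infinite combinations, for which the field would have to be
  complete.\<close>

lemma not_orthocomplemented_of_not_well_ordered:
  assumes G: "g \<in> G" "g < 1" and B: "convex_base G X act B" and "\<not> well_ordered B"
  shows "\<exists>D. subspace D \<and> closedin T D \<and> \<not> orthocomplemented scale nrm D"
proof -
  obtain A t0 where A: "A \<subseteq> B" "t0 \<in> A" and no_min: "\<And>t. t \<in> A \<Longrightarrow> \<exists>r\<in>A. r < t"
    using assms(4) unfolding well_ordered_def by (metis ex_in_conv not_le)
  have base: "is_base G X act B"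
    using B by (simp add: convex_base_def)
  have AX: "A \<subseteq> X"
    using A base by (auto simp: is_base_def)
  have "\<exists>e. \<forall>t\<in>A. nrm (e t) = Some t"
    using AX in_X_nrmE by (intro bchoice) blast
  then obtain e where e: "\<And>t. t \<in> A \<Longrightarrow> nrm (e t) = Some t"
    by blast
  define D where "D = {\<Sum>t\<in>F. scale (c t) (e t) |F c. finite F \<and> F \<subseteq> A \<and> sum c F = 0}"
  have D: "subspace D"
    unfolding D_def by (rule subspace_zero_sum_combinations)
  let ?C = "T closure_of D"
  note iff = in_closure_iff[OF subspace_nonempty[OF D]]
  have far: "\<exists>t\<in>A. Some t \<le> nrm (e t0 - d)" if d: "d \<in> D" for d
  proof -
    obtain F c where F: "finite F" "F \<subseteq> A" "sum c F = 0" "d = (\<Sum>t\<in>F. scale (c t) (e t))"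
      using d unfolding D_def by blast
    define H where "H = insert t0 F"
    define c' where "c' = (\<lambda>t. (if t \<in> {t0} then 1 else 0) - (if t \<in> F then c t else 0))"
    have H: "finite H" "{t0} \<subseteq> H" "F \<subseteq> H" "H \<subseteq> A"
      using F(1,2) A(2) by (auto simp: H_def)
    have "sum c' H = (\<Sum>t\<in>{t0}. 1) - sum c F"
      unfolding c'_def sum_subtractf using H by (simp only: zero_extension)
    then have sum_1: "sum c' H = 1"
      using F(3) by simp
    have "(\<Sum>t\<in>H. scale (c' t) (e t)) = (\<Sum>t\<in>{t0}. scale 1 (e t)) - d"
      unfolding c'_def scale_left_diff_distrib sum_subtractf F(4) using H by (simp only: zero_extension)
    then have sum_e: "(\<Sum>t\<in>H. scale (c' t) (e t)) = e t0 - d"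
      by simp
    have "\<exists>t\<in>H. Some t \<le> nrm (\<Sum>t\<in>H. scale (c' t) (e t))"
      using H(1,4) A(1) e sum_1 by (intro nrm_combination_ge[OF base]) auto
    then show ?thesis
      unfolding sum_e using H(4) by blast
  qed
  have near: "e t0 - e t \<in> D" if "t \<in> A" "t \<noteq> t0" for t
    unfolding D_def using that A
    by (auto intro!: exI[of _ "{t0, t}"] exI[of _ "\<lambda>r. if r = t then -1 else 1"])
  have "\<not> orthocomplemented scale nrm ?C"
  proof
    assume "orthocomplemented scale nrm ?C"
    then obtain d where d: "d \<in> ?C" and best: "\<And>d'. d' \<in> ?C \<Longrightarrow> nrm (e t0 - d) \<le> nrm (e t0 - d')"
      using orthocomplemented_imp_best_approximation subspace_closure[OF D] by metis
    have DC: "D \<subseteq> ?C"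
      by (intro closure_of_subset) simp
    \<comment> \<open>Elements of \<open>D\<close> stay at distance more than \<open>g t0\<close>, which lies below all of \<open>B\<close>.\<close>
    have "e t0 - d \<noteq> 0"
    proof
      assume "e t0 - d = 0"
      moreover have "act g t0 \<in> X"
        using G A AX by (intro act_in_X) auto
      ultimately obtain d' where d': "d' \<in> D" "nrm (d' - e t0) < Some (act g t0)"
        using d unfolding iff by auto
      then obtain t where t: "t \<in> A" "Some t \<le> nrm (e t0 - d')"
        using far by blast
      have "Some t < Some (act g t0)"
        using d'(2) t(2) unfolding nrm_diff_commute[of "e t0"] by (rule le_less_trans[rotated])
      moreover have "act g t0 < t"
        using convex_base_contraction_less[OF B G] A t(1) by blast
      ultimately show False
        by simp
    qed
    then obtain x where x: "x \<in> X" "nrm (e t0 - d) = Some x"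
      by (rule nrm_nonzeroE)
    then obtain d' where d': "d' \<in> D" "nrm (d' - d) < Some x"
      using d unfolding iff by blast
    \<comment> \<open>The minimal distance is also attained in \<open>D\<close> itself, where every distance is at least some element of \<open>A\<close>.\<close>
    have "nrm (e t0 - d') = Some x"
      using nrm_add_eq_right[of "d - d'" "e t0 - d"] d' x nrm_diff_commute[of d d'] by simp
    then obtain t where t: "t \<in> A" "t \<le> x"
      using far[OF d'(1)] by auto
    obtain r where r: "r \<in> A" "r < t"
      using no_min t by blast
    have "x \<le> r"
    proof (cases "r = t0")
      case True
      have "nrm (e t0 - d) \<le> nrm (e t0 - 0)"
        using D DC subspace_0 by (intro best) auto
      then show ?thesis
        using True x e A by simp
    next
      case False
      have "nrm (e t0 - d) \<le> nrm (e t0 - (e t0 - e r))"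
        using near[OF r(1) False] DC by (intro best) auto
      then show ?thesis
        using x e r by simp
    qed
    then show False
      using r t by simp
  qed
  then show ?thesis
    using subspace_closure[OF D] closedin_closure_of[of T D] by blast
qed

end

theorem theorem4p1:
  fixes v :: "'k::field \<Rightarrow> real" and g0 :: real
    and scale :: "'k \<Rightarrow> 'e::ab_group_add \<Rightarrow> 'e"
    and nrm :: "'e \<Rightarrow> 'x::linorder option"
    and act :: "real \<Rightarrow> 'x \<Rightarrow> 'x"
    and X B :: "'x set"
  assumes "valuation v"
    and "value_group v = cyclic_group g0"
    and "X = norm_values nrm"
    and "G_module (value_group v) X act"
    and "Banach_space v X act scale nrm"
    and "convex_base (value_group v) X act B"
  shows "norm_Hilbert_space v X act scale nrm \<longleftrightarrow> well_ordered B"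
proof -
  interpret X_normed_space scale v X act nrm
    using assms by (auto simp: X_normed_space_def X_normed_space_axioms_def Banach_space_def)
  show ?thesis
  proof
    assume H: "norm_Hilbert_space v X act scale nrm"
    show "well_ordered B"
    proof (rule ccontr)
      assume not_wo: "\<not> well_ordered B"
      then have "X \<noteq> {}"
        using assms(6) by (auto simp: well_ordered_def convex_base_def is_base_def)
      then obtain g where "g < 1" "value_group v = cyclic_group g"
        using cyclic_contraction[OF assms(2)] by blast
      moreover from this have "g \<in> value_group v"
        by (auto simp: cyclic_group_def intro: range_eqI[of _ _ 1])
      ultimately show False
        using not_orthocomplemented_of_not_well_ordered[OF _ _ assms(6) not_wo] H
        unfolding norm_Hilbert_space_def by blast
    qed
  next
    assume "well_ordered B"
    then show "norm_Hilbert_space v X act scale nrm"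
      using assms(5) closed_subspace_orthocomplemented well_ordered_above[OF assms(2,6)]
      unfolding norm_Hilbert_space_def Banach_space_def by blast
  qed
qed

end
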